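(* For $1\le\gamma<\nu\le n$ and $(r,s,i,j)\in\mu^{-1}(0)^{rss}$ put $K_{\gamma\nu}(r,s,i,j):=(r_{\nu\nu}-r_{\gamma\gamma})^{-1}$. Then $$K_{\gamma\nu}(r,s,i,j)=\big[\mathrm{tr}\big((L^{\nu}-L^{\gamma})r\big)\big]^{-1},$$ and this is a $B$-invariant function.
   Context: Let $n\ge 1$, $\mathfrak{g}=\mathfrak{gl}_n(\mathbb{C})$, $B\subset GL_n(\mathbb{C})$ the group of invertible upper triangular matrices, $\mathfrak{b}$ the upper triangular matrices, $\mathfrak{u}\subset\mathfrak{g}$ the strictly upper triangular matrices. Identify $\mathfrak{b}^*\cong\mathfrak{g}/\mathfrak{u}$ via the trace pairing; $\overline{v}$ is the class of $v$ in $\mathfrak{g}/\mathfrak{u}$. $T^*(\mathfrak{b}\times\mathbb{C}^n)=\mathfrak{b}\times\mathfrak{b}^*\times\mathbb{C}^n\times(\mathbb{C}^n)^*$ has points $(r,s,i,j)$, $i$ a column vector and $j$ a row vector. $B$ acts by $b.(r,s,i,j)=(brb^{-1},\overline{bsb^{-1}},bi,jb^{-1})$. The moment map is $\mu(r,s,i,j)=\overline{[r,s]+ij}\in\mathfrak{b}^*$, and $\mu^{-1}(0)^{rss}$ is the set of $(r,s,i,j)\in\mu^{-1}(0)$ with $r$ having pairwise distinct eigenvalues. For $r=(r_{\iota\gamma})\in\mathfrak{b}$, $l_k(r)=r-r_{kk}I_n$ and $L^{\iota}=[\mathrm{tr}(\prod_{1\le k\le n,k\ne\iota}l_k(r))]^{-1}\prod_{1\le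 k\le n,k\neq\iota}l_k(r)$ (empty product is $I_n$). *)

theory Defs
  imports "Jordan_Normal_Form.Spectral_Radius" "HOL-Algebra.AbelCoset"
begin

text \<open>
  Matrices are those of the theory \<open>Jordan_Normal_Form.Matrix\<close>, whose rows and columns are
  numbered \<open>0, \<dots>, n - 1\<close>; so every index is one less than in the usual \<open>1, \<dots>, n\<close> numbering.
  Column vectors are \<open>n \<times> 1\<close> matrices and row vectors are \<open>1 \<times> n\<close> matrices.
\<close>

abbreviation gl :: "nat \<Rightarrow> complex mat ring" where
  "gl n \<equiv> ring_mat TYPE(complex) n ()"

definition borel_group :: "nat \<Rightarrow> complex mat set" where
  "borel_group n = {b \<in> Units (gl n). upper_triangular b}"

definition borel_algebra :: "nat \<Rightarrow> complex mat set" where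
  "borel_algebra n = {r \<in> carrier_mat n n. upper_triangular r}"

definition strict_upper :: "nat \<Rightarrow> complex mat set" where
  "strict_upper n = {v \<in> carrier_mat n n. \<forall>i < n. \<forall>j \<le> i. v $$ (i, j) = 0}"

text \<open>
  The dual of the Borel subalgebra is represented, via the trace pairing, by the quotient
  \<open>\<gg>\<ll>\<^sub>n / \<uu>\<close>, whose elements are the additive cosets of \<open>\<uu>\<close>.
\<close>

definition borel_dual :: "nat \<Rightarrow> complex mat set set" where
  "borel_dual n = carrier (gl n A_Mod strict_upper n)"

definition cls :: "nat \<Rightarrow> complex mat \<Rightarrow> complex mat set" where
  "cls n v = strict_upper n +>\<^bsub>gl n\<^esub> v"

type_synonym point = "complex mat \<times> complex mat set \<times> complex mat \<times> complex mat"

definition cotangent :: "nat \<Rightarrow> point set" where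
  "cotangent n = borel_algebra n \<times> borel_dual n \<times> carrier_mat n 1 \<times> carrier_mat 1 n"

text \<open>
  The second component \<open>S\<close> of a point is a coset. The formulas below are applied to all its
  representatives \<open>s\<close>; the resulting cosets coincide (lemmas \<open>act_cls\<close> and \<open>moment_map_cls\<close>),
  so that their union is the class of the formula at any representative.
\<close>

definition act :: "nat \<Rightarrow> complex mat \<Rightarrow> point \<Rightarrow> point" where
  "act n b = (\<lambda>(r, S, i, j). let b' = inv\<^bsub>gl n\<^esub> b in
     (b * r * b', (\<Union>s\<in>S. cls n (b * s * b')), b * i, j * b'))"

definition moment_map :: "nat \<Rightarrow> point \<Rightarrow> complex mat set" where
  "moment_map n = (\<lambda>(r, S, i, j). \<Union>s\<in>S. cls n (r * s - s * r + i * j))"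

text \<open>
  An \<open>n \<times> n\<close> matrix has pairwise distinct eigenvalues iff its spectrum has \<open>n\<close> elements.
\<close>

definition mu_zero_rss :: "nat \<Rightarrow> point set" where
  "mu_zero_rss n = {x \<in> cotangent n. moment_map n x = cls n (0\<^sub>m n n) \<and> card (spectrum (fst x)) = n}"

definition B_invariant_on :: "nat \<Rightarrow> point set \<Rightarrow> (point \<Rightarrow> complex) \<Rightarrow> bool" where
  "B_invariant_on n X f \<longleftrightarrow>
     (\<forall>b \<in> borel_group n. \<forall>x \<in> X. act n b x \<in> X \<and> f (act n b x) = f x)"

definition mat_trace :: "complex mat \<Rightarrow> complex" where
  "mat_trace A = (\<Sum>i<dim_row A. A $$ (i, i))"

definition l_mat :: "nat \<Rightarrow> nat \<Rightarrow> complex mat \<Rightarrow> complex mat" where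
  "l_mat n k r = r - r $$ (k, k) \<cdot>\<^sub>m 1\<^sub>m n"

text \<open>
  The factors are polynomials in \<open>r\<close>, hence commute; the product is taken in increasing order.
\<close>

definition l_prod :: "nat \<Rightarrow> nat \<Rightarrow> complex mat \<Rightarrow> complex mat" where
  "l_prod n \<iota> r = foldr (\<lambda>k A. l_mat n k r * A) (filter (\<lambda>k. k \<noteq> \<iota>) [0..<n]) (1\<^sub>m n)"

definition L_mat :: "nat \<Rightarrow> nat \<Rightarrow> complex mat \<Rightarrow> complex mat" where
  "L_mat n \<iota> r = inverse (mat_trace (l_prod n \<iota> r)) \<cdot>\<^sub>m l_prod n \<iota> r"

definition K :: "nat \<Rightarrow> nat \<Rightarrow> point \<Rightarrow> complex" where
  "K \<gamma> \<nu> = (\<lambda>(r, S, i, j). inverse (r $$ (\<nu>, \<nu>) - r $$ (\<gamma>, \<gamma>)))"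


lemma cls_eq: "cls n v = {u + v | u. u \<in> strict_upper n}"
  by (auto simp: cls_def a_r_coset_def' ring_mat_simps)

lemma strict_upper_diff:
  "u \<in> strict_upper n \<Longrightarrow> v \<in> strict_upper n \<Longrightarrow> u - v \<in> strict_upper n"
  by (auto simp: strict_upper_def)

lemma strict_upper_add:
  "u \<in> strict_upper n \<Longrightarrow> v \<in> strict_upper n \<Longrightarrow> u + v \<in> strict_upper n"
  by (auto simp: strict_upper_def)

lemma strict_upper_carrier: "u \<in> strict_upper n \<Longrightarrow> u \<in> carrier_mat n n"
  by (simp add: strict_upper_def)

lemma strict_upper_mult_left:
  assumes "u \<in> strict_upper n" "b \<in> carrier_mat n n" "upper_triangular b"
  shows "b * u \<in> strict_upper n"
proof -
  have "b $$ (i, k) * u $$ (k, j) = 0" if "i < n" "j \<le> i" "k < n" for i j k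
    using assms that by (cases "k < i") (auto simp: strict_upper_def upper_triangular_def)
  then show ?thesis
    using assms by (auto simp: strict_upper_def scalar_prod_def intro!: sum.neutral)
qed

lemma strict_upper_mult_right:
  assumes "u \<in> strict_upper n" "b \<in> carrier_mat n n" "upper_triangular b"
  shows "u * b \<in> strict_upper n"
proof -
  have "u $$ (i, k) * b $$ (k, j) = 0" if "i < n" "j \<le> i" "k < n" for i j k
    using assms that by (cases "k \<le> i") (auto simp: strict_upper_def upper_triangular_def)
  then show ?thesis
    using assms by (auto simp: strict_upper_def scalar_prod_def intro!: sum.neutral)
qed

lemma cls_add:
  assumes "u \<in> strict_upper n" "v \<in> carrier_mat n n"
  shows "cls n (u + v) = cls n v"
proof -
  have uc: "u \<in> carrier_mat n n" using assms(1) by (rule strict_upper_carrier)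
  have 1: "w + (u + v) = (w + u) + v" if "w \<in> strict_upper n" for w
    using strict_upper_carrier[OF that] uc assms(2) by (simp add: assoc_add_mat[of _ n n])
  have 2: "w + v = (w - u) + (u + v)" if "w \<in> strict_upper n" for w
    by (rule eq_matI) (use strict_upper_carrier[OF that] uc assms(2) in auto)
  show ?thesis
  proof (intro equalityI subsetI)
    fix x assume "x \<in> cls n (u + v)"
    then obtain w where "w \<in> strict_upper n" "x = w + (u + v)" by (auto simp: cls_eq)
    then show "x \<in> cls n v"
      using 1 strict_upper_add[OF _ assms(1)] by (auto simp: cls_eq)
  next
    fix x assume "x \<in> cls n v"
    then obtain w where "w \<in> strict_upper n" "x = w + v" by (auto simp: cls_eq)
    then show "x \<in> cls n (u + v)"
      using 2 strict_upper_diff[OF _ assms(1)] by (auto simp: cls_eq)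
  qed
qed

lemma zero_in_strict_upper: "0\<^sub>m n n \<in> strict_upper n"
  by (simp add: strict_upper_def)

lemma inv_borel_group:
  assumes "b \<in> borel_group n"
  shows "inv\<^bsub>gl n\<^esub> b \<in> borel_group n"
proof -
  interpret G: ring "gl n" by (rule ring_mat)
  define c where "c = inv\<^bsub>gl n\<^esub> b"
  have bU: "b \<in> Units (gl n)" and bt: "upper_triangular b"
    using assms by (auto simp: borel_group_def)
  have cU: "c \<in> Units (gl n)" unfolding c_def using bU by (rule G.Units_inv_Units)
  have bc: "b \<in> carrier_mat n n" "c \<in> carrier_mat n n"
    using G.Units_closed[OF bU] G.Units_closed[OF cU] by (auto simp: ring_mat_simps)
  have cb: "c * b = 1\<^sub>m n"
    using G.Units_l_inv[OF bU] by (simp add: c_def ring_mat_simps)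
  have "det c * det b = 1"
    using det_mult[OF bc(2,1)] cb by simp
  then have "0 \<notin> set (diag_mat b)"
    using upper_triangular_imp_det_eq_0_iff[OF bc(1) bt] by auto
  then have diag: "b $$ (j, j) \<noteq> 0" if "j < n" for j
    using that bc by (force simp: diag_mat_def)
  have "c $$ (i, j) = 0" if "i < n" "j < i" for i j
    using that(2)
  proof (induction j rule: less_induct)
    case (less j)
    have "0 = (c * b) $$ (i, j)"
      using cb that less.prems by simp
    also have "\<dots> = (\<Sum>k<n. c $$ (i, k) * b $$ (k, j))"
      using bc that less.prems by (simp add: scalar_prod_def lessThan_atLeast0)
    also have "\<dots> = (\<Sum>k<n. if k = j then c $$ (i, j) * b $$ (j, j) else 0)"
    proof (rule sum.cong[OF refl])
      fix k assume "k \<in> {..<n}"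
      then show "c $$ (i, k) * b $$ (k, j) = (if k = j then c $$ (i, j) * b $$ (j, j) else 0)"
        using less bt bc by (cases k j rule: linorder_cases) (auto simp: upper_triangular_def)
    qed
    also have "\<dots> = c $$ (i, j) * b $$ (j, j)"
      using that less.prems by simp
    finally show ?case using diag[of j] that less.prems by auto
  qed
  then have "upper_triangular c" using bc by (auto simp: upper_triangular_def)
  then show ?thesis using cU by (simp add: borel_group_def c_def)
qed

lemma moment_map_cls:
  assumes "r \<in> borel_algebra n" "s \<in> carrier_mat n n" "i \<in> carrier_mat n 1" "j \<in> carrier_mat 1 n"
  shows "moment_map n (r, cls n s, i, j) = cls n (r * s - s * r + i * j)"
proof -
  have rearrange: "(A + B) - (C + D) + E = (A - C) + (B - D + E)"
    if "A \<in> carrier_mat n n" "C \<in> carrier_mat n n" "B \<in> carrier_mat n n"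
      "D \<in> carrier_mat n n" "E \<in> carrier_mat n n" for A B C D E :: "complex mat"
    by (rule eq_matI) (use that in auto)
  have r: "r \<in> carrier_mat n n" "upper_triangular r"
    using assms(1) by (auto simp: borel_algebra_def)
  have "cls n (r * (u + s) - (u + s) * r + i * j) = cls n (r * s - s * r + i * j)"
    if u: "u \<in> strict_upper n" for u
  proof -
    have uc: "u \<in> carrier_mat n n" using u by (rule strict_upper_carrier)
    have ru: "r * u \<in> carrier_mat n n" "u * r \<in> carrier_mat n n" "r * s \<in> carrier_mat n n"
      "s * r \<in> carrier_mat n n" "i * j \<in> carrier_mat n n"
      using r uc assms by auto
    have "r * (u + s) - (u + s) * r + i * j
        = (r * u + r * s) - (u * r + s * r) + i * j"
      using r uc assms by (simp add: mult_add_distrib_mat[of _ n n] add_mult_distrib_mat[of _ n n])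
    also have "\<dots> = (r * u - u * r) + (r * s - s * r + i * j)"
      by (rule rearrange) (rule ru)+
    finally show ?thesis
      using cls_add[OF strict_upper_diff[OF strict_upper_mult_left[OF u r]
            strict_upper_mult_right[OF u r]], of "r * s - s * r + i * j"] ru by simp
  qed
  then show ?thesis
    unfolding moment_map_def cls_eq[of n s] using zero_in_strict_upper[of n] by auto
qed

lemma act_cls:
  assumes b: "b \<in> borel_group n" and s: "s \<in> carrier_mat n n"
  shows "act n b (r, cls n s, i, j) =
    (b * r * inv\<^bsub>gl n\<^esub> b, cls n (b * s * inv\<^bsub>gl n\<^esub> b), b * i, j * inv\<^bsub>gl n\<^esub> b)"
proof -
  define b' where "b' = inv\<^bsub>gl n\<^esub> b"
  have b1: "b \<in> carrier_mat n n" "upper_triangular b"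
    using b by (auto simp: borel_group_def Units_def ring_mat_simps)
  have b2: "b' \<in> carrier_mat n n" "upper_triangular b'"
    using inv_borel_group[OF b] by (auto simp: b'_def borel_group_def Units_def ring_mat_simps)
  have "cls n (b * (u + s) * b') = cls n (b * s * b')" if u: "u \<in> strict_upper n" for u
  proof -
    have uc: "u \<in> carrier_mat n n" using u by (rule strict_upper_carrier)
    have "b * (u + s) * b' = b * u * b' + b * s * b'"
      using b1 b2 uc s by (simp add: mult_add_distrib_mat[of _ n n] add_mult_distrib_mat[of _ n n])
    then show ?thesis
      using cls_add[OF strict_upper_mult_right[OF strict_upper_mult_left[OF u b1] b2],
          of "b * s * b'"] b1 b2 s by simp
  qed
  then have "(\<Union>v\<in>cls n s. cls n (b * v * b')) = cls n (b * s * b')"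
    unfolding cls_eq[of n s] using zero_in_strict_upper[of n] by auto
  then show ?thesis by (simp add: act_def b'_def Let_def)
qed

end

theory Submission
  imports Defs
begin

text \<open>
  Everything reduces to diagonals, because taking the diagonal is multiplicative on upper
  triangular matrices.

  The spectrum of an upper triangular \<open>r\<close> is the set of its diagonal entries, so having \<open>n\<close>
  eigenvalues means that these entries are distinct. The product of the \<open>l\<^sub>k(r)\<close> over \<open>k \<noteq> \<iota>\<close> is
  upper triangular with \<open>m\<close>-th diagonal entry \<open>\<Prod>\<^sub>k (r\<^sub>m\<^sub>m - r\<^sub>k\<^sub>k)\<close>. It vanishes for \<open>m \<noteq> \<iota>\<close>,
  since then \<open>k = m\<close> is among the factors, and it is non-zero for \<open>m = \<iota>\<close>. The diagonal of
  \<open>L\<^sup>\<iota>\<close> is thus the unit vector at \<open>\<iota>\<close>, whence \<open>tr (L\<^sup>\<iota> r) = r\<^sub>\<iota>\<^sub>\<iota>\<close>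
  (\<open>mat_trace_L_mat_mult\<close>), and the formula for \<open>K\<close> follows by subtraction.

  For the invariance, conjugation by \<open>b \<in> B\<close> does not change the diagonal of \<open>r\<close>, since the
  diagonals of \<open>b\<close> and of its inverse multiply to \<open>1\<close>. Hence it changes neither the value of \<open>K\<close> nor
  the spectrum. The action also preserves the zero fibre of the moment map: conjugating \<open>r\<close>, \<open>s\<close> and
  \<open>ij\<close> conjugates \<open>[r,s] + ij\<close>, and \<open>\<uu>\<close> is stable under conjugation by \<open>B\<close>.
\<close>

section \<open>Diagonals of upper triangular matrices\<close>

lemma borel_algebraD:
  assumes "r \<in> borel_algebra n"
  shows "r \<in> carrier_mat n n" "upper_triangular r"
  using assms by (auto simp: borel_algebra_def)

lemma one_in_borel_algebra: "1\<^sub>m n \<in> borel_algebra n"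
  by (simp add: borel_algebra_def)

lemma borel_algebra_mult:
  assumes "a \<in> borel_algebra n" "b \<in> borel_algebra n"
  shows "a * b \<in> borel_algebra n"
proof -
  note a = borel_algebraD[OF assms(1)] and b = borel_algebraD[OF assms(2)]
  have "a $$ (i, k) * b $$ (k, j) = 0" if "i < n" "j < i" "k < n" for i j k
    using a b that by (cases "k < i") (auto simp: upper_triangular_def)
  then show ?thesis
    using a b by (auto simp: borel_algebra_def upper_triangular_def scalar_prod_def
        intro!: sum.neutral)
qed

text \<open>
  In the sum for the entry at \<open>(m, m)\<close>, the terms below the index \<open>m\<close> vanish because of \<open>a\<close> and
  those above it because of \<open>b\<close>.
\<close>

lemma borel_algebra_mult_diag:
  assumes "a \<in> borel_algebra n" "b \<in> borel_algebra n" "m < n"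
  shows "(a * b) $$ (m, m) = a $$ (m, m) * b $$ (m, m)"
proof -
  note a = borel_algebraD[OF assms(1)] and b = borel_algebraD[OF assms(2)]
  have "(a * b) $$ (m, m) = (\<Sum>k<n. a $$ (m, k) * b $$ (k, m))"
    using a b assms(3) by (simp add: scalar_prod_def lessThan_atLeast0)
  also have "\<dots> = (\<Sum>k<n. if k = m then a $$ (m, m) * b $$ (m, m) else 0)"
  proof (rule sum.cong[OF refl])
    fix k assume "k \<in> {..<n}"
    then show "a $$ (m, k) * b $$ (k, m) = (if k = m then a $$ (m, m) * b $$ (m, m) else 0)"
      using a b assms(3) by (cases k m rule: linorder_cases) (auto simp: upper_triangular_def)
  qed
  also have "\<dots> = a $$ (m, m) * b $$ (m, m)"
    using assms(3) by simp
  finally show ?thesis .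
qed

lemma spectrum_borel_algebra:
  assumes "r \<in> borel_algebra n"
  shows "spectrum r = (\<lambda>k. r $$ (k, k)) ` {..<n}"
proof -
  note r = borel_algebraD[OF assms]
  have "spectrum r = set (diag_mat r)"
    unfolding spectrum_root_char_poly[OF r(1)] char_poly_upper_triangular[OF r]
    by (auto simp: poly_prod_list prod_list_zero_iff)
  also have "\<dots> = (\<lambda>k. r $$ (k, k)) ` {..<n}"
    using r(1) by (auto simp: diag_mat_def)
  finally show ?thesis .
qed

lemma card_spectrum_borel_algebra_iff:
  assumes "r \<in> borel_algebra n"
  shows "card (spectrum r) = n \<longleftrightarrow> inj_on (\<lambda>k. r $$ (k, k)) {..<n}"
  using inj_on_iff_eq_card[of "{..<n}" "\<lambda>k. r $$ (k, k)"]
  by (simp add: spectrum_borel_algebra[OF assms])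

section \<open>The trace formula\<close>

lemma l_mat_borel_algebra:
  assumes "r \<in> borel_algebra n"
  shows "l_mat n k r \<in> borel_algebra n"
  using borel_algebraD[OF assms] by (auto simp: l_mat_def borel_algebra_def upper_triangular_def)

lemma l_mat_diag:
  assumes "r \<in> borel_algebra n" "m < n"
  shows "l_mat n k r $$ (m, m) = r $$ (m, m) - r $$ (k, k)"
  using borel_algebraD[OF assms(1)] assms(2) by (simp add: l_mat_def)

text \<open>
  The list of indices is arbitrary, so that induction on it is possible; membership in the Borel
  subalgebra has to be carried along, since it is what makes the diagonal multiplicative.
\<close>

lemma foldr_l_mat:
  assumes "r \<in> borel_algebra n"
  shows "foldr (\<lambda>k A. l_mat n k r * A) ks (1\<^sub>m n) \<in> borel_algebra n \<and>
    (\<forall>m < n. foldr (\<lambda>k A. l_mat n k r * A) ks (1\<^sub>m n) $$ (m, m) =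
      (\<Prod>k\<leftarrow>ks. r $$ (m, m) - r $$ (k, k)))"
proof (induction ks)
  case Nil
  then show ?case by (simp add: one_in_borel_algebra)
next
  case (Cons k ks)
  then show ?case
    using l_mat_borel_algebra[OF assms, of k]
    by (simp add: borel_algebra_mult borel_algebra_mult_diag l_mat_diag[OF assms])
qed

lemma l_prod_borel_algebra:
  assumes "r \<in> borel_algebra n"
  shows "l_prod n \<iota> r \<in> borel_algebra n"
  unfolding l_prod_def using foldr_l_mat[OF assms] by blast

lemma l_prod_diag:
  assumes "r \<in> borel_algebra n" "m < n"
  shows "l_prod n \<iota> r $$ (m, m) = (\<Prod>k\<in>{..<n} - {\<iota>}. r $$ (m, m) - r $$ (k, k))"
proof -
  have "l_prod n \<iota> r $$ (m, m) =
      (\<Prod>k\<leftarrow>filter (\<lambda>k. k \<noteq> \<iota>) [0..<n]. r $$ (m, m) - r $$ (k, k))"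
    unfolding l_prod_def using foldr_l_mat[OF assms(1)] assms(2) by blast
  also have "\<dots> = (\<Prod>k\<in>set (filter (\<lambda>k. k \<noteq> \<iota>) [0..<n]). r $$ (m, m) - r $$ (k, k))"
    by (rule prod.distinct_set_conv_list[symmetric]) simp
  also have "set (filter (\<lambda>k. k \<noteq> \<iota>) [0..<n]) = {..<n} - {\<iota>}"
    by auto
  finally show ?thesis .
qed

text \<open>The factor with \<open>k = m\<close> is zero.\<close>

lemma l_prod_diag_off:
  assumes "r \<in> borel_algebra n" "m < n" "m \<noteq> \<iota>"
  shows "l_prod n \<iota> r $$ (m, m) = 0"
  using assms by (auto simp: l_prod_diag intro!: prod_zero bexI[of _ m])

text \<open>
  Only the entry at \<open>\<iota>\<close> survives on the diagonal of the product of the \<open>l\<^sub>k(r)\<close>, so that the trace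
  of its product with any upper triangular \<open>a\<close> sees nothing else of \<open>a\<close>. The case \<open>a = 1\<close> gives the
  normalising factor of \<open>L\<^sup>\<iota>\<close>.
\<close>

lemma mat_trace_l_prod_mult:
  assumes "r \<in> borel_algebra n" "a \<in> borel_algebra n" "\<iota> < n"
  shows "mat_trace (l_prod n \<iota> r * a) = l_prod n \<iota> r $$ (\<iota>, \<iota>) * a $$ (\<iota>, \<iota>)"
proof -
  note p = l_prod_borel_algebra[OF assms(1), of \<iota>]
  have "mat_trace (l_prod n \<iota> r * a) = (\<Sum>m<n. (l_prod n \<iota> r * a) $$ (m, m))"
    using borel_algebraD[OF p] by (simp add: mat_trace_def)
  also have "\<dots> = (\<Sum>m<n. if m = \<iota> then l_prod n \<iota> r $$ (\<iota>, \<iota>) * a $$ (\<iota>, \<iota>) else 0)"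
    by (rule sum.cong[OF refl])
      (simp add: borel_algebra_mult_diag[OF p assms(2)] l_prod_diag_off[OF assms(1)])
  also have "\<dots> = l_prod n \<iota> r $$ (\<iota>, \<iota>) * a $$ (\<iota>, \<iota>)"
    using assms(3) by simp
  finally show ?thesis .
qed

lemma mat_trace_l_prod:
  assumes "r \<in> borel_algebra n" "\<iota> < n"
  shows "mat_trace (l_prod n \<iota> r) = l_prod n \<iota> r $$ (\<iota>, \<iota>)"
  using mat_trace_l_prod_mult[OF assms(1) one_in_borel_algebra assms(2)]
    borel_algebraD(1)[OF l_prod_borel_algebra[OF assms(1), of \<iota>]] assms(2)
  by simp

lemma mat_trace_l_prod_nonzero:
  assumes "r \<in> borel_algebra n" "inj_on (\<lambda>k. r $$ (k, k)) {..<n}" "\<iota> < n"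
  shows "mat_trace (l_prod n \<iota> r) \<noteq> 0"
  using assms by (auto simp: mat_trace_l_prod l_prod_diag inj_on_def)

lemma mat_trace_smult: "mat_trace (c \<cdot>\<^sub>m A) = c * mat_trace A"
  if "A \<in> carrier_mat n n"
  using that by (simp add: mat_trace_def sum_distrib_left)

lemma mat_trace_minus: "mat_trace (A - B) = mat_trace A - mat_trace B"
  if "A \<in> carrier_mat n n" "B \<in> carrier_mat n n"
  using that by (simp add: mat_trace_def sum_subtractf)

lemma mat_trace_L_mat_mult:
  assumes "r \<in> borel_algebra n" "inj_on (\<lambda>k. r $$ (k, k)) {..<n}" "a \<in> borel_algebra n" "\<iota> < n"
  shows "mat_trace (L_mat n \<iota> r * a) = a $$ (\<iota>, \<iota>)"
proof -
  have p: "l_prod n \<iota> r \<in> carrier_mat n n" and a: "a \<in> carrier_mat n n"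
    using borel_algebraD l_prod_borel_algebra assms by blast+
  have "mat_trace (L_mat n \<iota> r * a) =
      inverse (mat_trace (l_prod n \<iota> r)) * mat_trace (l_prod n \<iota> r * a)"
    using p a by (simp add: L_mat_def mult_smult_assoc_mat[OF p a] mat_trace_smult[of _ n])
  then show ?thesis
    using mat_trace_l_prod_nonzero[OF assms(1,2,4)] assms
    by (simp add: mat_trace_l_prod_mult mat_trace_l_prod)
qed

lemma mat_trace_L_mat_diff_mult:
  assumes "r \<in> borel_algebra n" "inj_on (\<lambda>k. r $$ (k, k)) {..<n}" "a \<in> borel_algebra n"
    and "\<nu> < n" "\<gamma> < n"
  shows "mat_trace ((L_mat n \<nu> r - L_mat n \<gamma> r) * a) = a $$ (\<nu>, \<nu>) - a $$ (\<gamma>, \<gamma>)"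
proof -
  have L: "L_mat n \<iota> r \<in> carrier_mat n n" for \<iota>
    using borel_algebraD(1)[OF l_prod_borel_algebra[OF assms(1)]] by (simp add: L_mat_def)
  have a: "a \<in> carrier_mat n n"
    using borel_algebraD assms(3) by blast
  have "mat_trace ((L_mat n \<nu> r - L_mat n \<gamma> r) * a) =
      mat_trace (L_mat n \<nu> r * a) - mat_trace (L_mat n \<gamma> r * a)"
    unfolding minus_mult_distrib_mat[OF L L a]
    by (rule mat_trace_minus) (rule mult_carrier_mat[OF L a])+
  then show ?thesis
    using assms by (simp add: mat_trace_L_mat_mult)
qed

section \<open>The action on the zero fibre\<close>

lemma borel_groupD:
  assumes "b \<in> borel_group n"
  shows "b \<in> borel_algebra n" "inv\<^bsub>gl n\<^esub> b \<in> borel_algebra n"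
    and "b * inv\<^bsub>gl n\<^esub> b = 1\<^sub>m n" "inv\<^bsub>gl n\<^esub> b * b = 1\<^sub>m n"
proof -
  interpret G: ring "gl n" by (rule ring_mat)
  have sub: "c \<in> borel_algebra n" if "c \<in> borel_group n" for c
    using that by (auto simp: borel_group_def borel_algebra_def Units_def ring_mat_simps)
  show "b \<in> borel_algebra n" "inv\<^bsub>gl n\<^esub> b \<in> borel_algebra n"
    using assms inv_borel_group sub by blast+
  have "b \<in> Units (gl n)"
    using assms by (simp add: borel_group_def)
  then show "b * inv\<^bsub>gl n\<^esub> b = 1\<^sub>m n" "inv\<^bsub>gl n\<^esub> b * b = 1\<^sub>m n"
    using G.Units_r_inv[of b] G.Units_l_inv[of b] by (simp_all add: ring_mat_simps)
qed

lemma borel_conj_diag: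
  assumes "b \<in> borel_group n" "r \<in> borel_algebra n" "m < n"
  shows "(b * r * inv\<^bsub>gl n\<^esub> b) $$ (m, m) = r $$ (m, m)"
proof -
  note b = borel_groupD[OF assms(1)]
  have "b $$ (m, m) * (inv\<^bsub>gl n\<^esub> b) $$ (m, m) = 1"
    using borel_algebra_mult_diag[OF b(1,2) assms(3)] b(3) assms(3) by simp
  then show ?thesis
    using assms b borel_algebra_mult[OF b(1) assms(2)]
    by (simp add: borel_algebra_mult_diag mult.commute mult.left_commute)
qed

lemma borel_dual_iff: "S \<in> borel_dual n \<longleftrightarrow> (\<exists>s \<in> carrier_mat n n. S = cls n s)"
  by (auto simp: borel_dual_def A_FactGroup_def FactGroup_def A_RCOSETS_def RCOSETS_def
      cls_def a_r_coset_def ring_mat_simps)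

text \<open>
  This turns the moment map equation into a condition on one representative, where the stability of
  \<open>\<uu>\<close> under multiplication by \<open>B\<close> can be applied.
\<close>

lemma cls_eq_zero_iff:
  assumes "v \<in> carrier_mat n n"
  shows "cls n v = cls n (0\<^sub>m n n) \<longleftrightarrow> v \<in> strict_upper n"
proof
  assume "cls n v = cls n (0\<^sub>m n n)"
  moreover have "v \<in> cls n v"
    using zero_in_strict_upper assms by (auto simp: cls_eq intro!: exI[of _ "0\<^sub>m n n"])
  ultimately obtain u where u: "u \<in> strict_upper n" "v = u + 0\<^sub>m n n"
    by (auto simp: cls_eq)
  then show "v \<in> strict_upper n"
    using strict_upper_carrier[OF u(1)] by simp
next
  assume v: "v \<in> strict_upper n"
  show "cls n v = cls n (0\<^sub>m n n)"
    using cls_add[OF v, of "0\<^sub>m n n"] assms by simp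
qed

lemma conj_mult:
  fixes b b' :: "'a :: comm_ring_1 mat"
  assumes "b \<in> carrier_mat n n" "b' \<in> carrier_mat n n" "b' * b = 1\<^sub>m n"
    and "x \<in> carrier_mat n n" "y \<in> carrier_mat n n"
  shows "(b * x * b') * (b * y * b') = b * (x * y) * b'"
proof -
  have "(b * x * b') * (b * y * b') = b * (x * ((b' * b) * (y * b')))"
    using assms(1,2,4,5) by (simp add: assoc_mult_mat[of _ n n _ n _ n])
  also have "\<dots> = b * (x * y) * b'"
    using assms by (simp add: assoc_mult_mat[of _ n n _ n _ n])
  finally show ?thesis .
qed

text \<open>
  Equivariance of \<open>[r,s] + ij\<close>: in \<open>rs\<close> and \<open>sr\<close> the inner \<open>b' b = 1\<close> cancels, while \<open>i\<close> is
  only multiplied on its left and \<open>j\<close> only on its right, which conjugates \<open>ij\<close>.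
\<close>

lemma moment_expression_conj:
  fixes b b' :: "'a :: comm_ring_1 mat"
  assumes b: "b \<in> carrier_mat n n" "b' \<in> carrier_mat n n" "b' * b = 1\<^sub>m n"
    and x: "r \<in> carrier_mat n n" "s \<in> carrier_mat n n" "i \<in> carrier_mat n 1" "j \<in> carrier_mat 1 n"
  shows "(b * r * b') * (b * s * b') - (b * s * b') * (b * r * b') + (b * i) * (j * b') =
    b * (r * s - s * r + i * j) * b'"
proof -
  have c: "r * s \<in> carrier_mat n n" "s * r \<in> carrier_mat n n" "i * j \<in> carrier_mat n n"
    using x by auto
  have ij: "(b * i) * (j * b') = b * (i * j) * b'"
    using assoc_mult_mat[OF b(1) x(3) mult_carrier_mat[OF x(4) b(2)]]
      assoc_mult_mat[OF x(3,4) b(2)] assoc_mult_mat[OF b(1) c(3) b(2)] by simp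
  have d: "r * s - s * r \<in> carrier_mat n n"
    using c(2) by (rule minus_carrier_mat)
  have "b * (r * s - s * r + i * j) * b' = b * (r * s - s * r) * b' + b * (i * j) * b'"
    unfolding mult_add_distrib_mat[OF b(1) d c(3)]
    by (rule add_mult_distrib_mat[of _ n n]) (use b c d in simp_all)
  also have "b * (r * s - s * r) * b' = b * (r * s) * b' - b * (s * r) * b'"
    unfolding mult_minus_distrib_mat[OF b(1) c(1,2)]
    by (rule minus_mult_distrib_mat[of _ n n]) (use b c in simp_all)
  finally have "b * (r * s - s * r + i * j) * b' =
      b * (r * s) * b' - b * (s * r) * b' + b * (i * j) * b'" .
  then show ?thesis
    by (simp only: ij conj_mult[OF b x(1,2)] conj_mult[OF b x(2,1)])
qed

text \<open>
  The moment map equation says that \<open>v = [r,s] + ij\<close> lies in \<open>\<uu>\<close>, and \<open>b\<close> replaces \<open>v\<close> by its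
  conjugate, which lies in \<open>\<uu>\<close> again. The condition on the spectrum is one on the diagonal of
  \<open>r\<close>, which \<open>b\<close> fixes.
\<close>

lemma act_mu_zero_rss:
  assumes b: "b \<in> borel_group n" and x: "x \<in> mu_zero_rss n"
  shows "act n b x \<in> mu_zero_rss n"
proof -
  obtain r S i j where x_rep: "x = (r, S, i, j)"
    by (cases x)
  have r: "r \<in> borel_algebra n" and S: "S \<in> borel_dual n"
    and i: "i \<in> carrier_mat n 1" and j: "j \<in> carrier_mat 1 n"
    and mu: "moment_map n x = cls n (0\<^sub>m n n)" and card: "card (spectrum r) = n"
    using x unfolding x_rep mu_zero_rss_def cotangent_def by simp_all
  obtain s where s: "s \<in> carrier_mat n n" and S_eq: "S = cls n s"
    using S borel_dual_iff by blast
  note x_eq = x_rep[unfolded S_eq]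
  define b' where "b' = inv\<^bsub>gl n\<^esub> b"
  note B = borel_groupD[OF b, folded b'_def]
  note bc = borel_algebraD[OF B(1)] borel_algebraD[OF B(2)]
  have rc: "r \<in> carrier_mat n n"
    using r by (rule borel_algebraD)
  have act: "act n b x = (b * r * b', cls n (b * s * b'), b * i, j * b')"
    unfolding x_eq b'_def by (rule act_cls[OF b s])
  have br: "b * r * b' \<in> borel_algebra n"
    using B r by (intro borel_algebra_mult)
  have cot: "act n b x \<in> cotangent n"
    unfolding act using br bc s i j by (auto simp: cotangent_def borel_dual_iff)
  define v where "v = r * s - s * r + i * j"
  have vc: "v \<in> carrier_mat n n"
    using rc s i j by (auto simp: v_def)
  have "cls n v = cls n (0\<^sub>m n n)"
    using mu moment_map_cls[OF r s i j] by (simp add: x_eq v_def)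
  then have "v \<in> strict_upper n"
    using cls_eq_zero_iff[OF vc] by simp
  then have "b * v * b' \<in> strict_upper n"
    using strict_upper_mult_right[OF strict_upper_mult_left] bc by blast
  then have "cls n (b * v * b') = cls n (0\<^sub>m n n)"
    using cls_eq_zero_iff strict_upper_carrier by blast
  moreover have "moment_map n (act n b x) = cls n (b * v * b')"
    unfolding act v_def moment_expression_conj[OF bc(1,3) B(4) rc s i j, symmetric]
    by (rule moment_map_cls[OF br]) (use bc s i j in simp_all)
  moreover have "spectrum (b * r * b') = spectrum r"
    unfolding spectrum_borel_algebra[OF br] spectrum_borel_algebra[OF r]
    using borel_conj_diag[OF b r] by (simp add: b'_def)
  ultimately show ?thesis
    using cot card by (simp add: mu_zero_rss_def act)
qed

lemma K_act:
  assumes "b \<in> borel_group n" "x \<in> mu_zero_rss n" "\<gamma> < n" "\<nu> < n"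
  shows "K \<gamma> \<nu> (act n b x) = K \<gamma> \<nu> x"
proof -
  obtain r S i j where x: "x = (r, S, i, j)"
    by (cases x)
  have r: "r \<in> borel_algebra n"
    using assms(2) unfolding x mu_zero_rss_def cotangent_def by simp
  show ?thesis
    by (simp add: x K_def act_def Let_def borel_conj_diag[OF assms(1) r] assms(3,4))
qed

theorem proposition6p12:
  fixes n \<gamma> \<nu> :: nat
  assumes "1 \<le> n" and "\<gamma> < \<nu>" and "\<nu> < n"
  shows "(\<forall>(r, S, i, j) \<in> mu_zero_rss n.
            r $$ (\<nu>, \<nu>) - r $$ (\<gamma>, \<gamma>) \<noteq> 0 \<and>
            (\<forall>\<iota> < n. mat_trace (l_prod n \<iota> r) \<noteq> 0) \<and>
            mat_trace ((L_mat n \<nu> r - L_mat n \<gamma> r) * r) \<noteq> 0 \<and>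
            K \<gamma> \<nu> (r, S, i, j) = inverse (mat_trace ((L_mat n \<nu> r - L_mat n \<gamma> r) * r)))
         \<and> B_invariant_on n (mu_zero_rss n) (K \<gamma> \<nu>)"
proof
  have \<gamma>: "\<gamma> < n"
    using assms by simp
  show "\<forall>(r, S, i, j) \<in> mu_zero_rss n.
            r $$ (\<nu>, \<nu>) - r $$ (\<gamma>, \<gamma>) \<noteq> 0 \<and>
            (\<forall>\<iota> < n. mat_trace (l_prod n \<iota> r) \<noteq> 0) \<and>
            mat_trace ((L_mat n \<nu> r - L_mat n \<gamma> r) * r) \<noteq> 0 \<and>
            K \<gamma> \<nu> (r, S, i, j) = inverse (mat_trace ((L_mat n \<nu> r - L_mat n \<gamma> r) * r))"
  proof clarify
    fix r S i j assume "(r, S, i, j) \<in> mu_zero_rss n"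
    then have r: "r \<in> borel_algebra n" and card: "card (spectrum r) = n"
      by (simp_all add: mu_zero_rss_def cotangent_def)
    have inj: "inj_on (\<lambda>k. r $$ (k, k)) {..<n}"
      using card card_spectrum_borel_algebra_iff[OF r] by blast
    have "r $$ (\<nu>, \<nu>) - r $$ (\<gamma>, \<gamma>) \<noteq> 0"
      using inj_onD[OF inj, of \<nu> \<gamma>] \<gamma> assms by auto
    then show "r $$ (\<nu>, \<nu>) - r $$ (\<gamma>, \<gamma>) \<noteq> 0 \<and>
            (\<forall>\<iota> < n. mat_trace (l_prod n \<iota> r) \<noteq> 0) \<and>
            mat_trace ((L_mat n \<nu> r - L_mat n \<gamma> r) * r) \<noteq> 0 \<and>
            K \<gamma> \<nu> (r, S, i, j) = inverse (mat_trace ((L_mat n \<nu> r - L_mat n \<gamma> r) * r))"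
      using mat_trace_L_mat_diff_mult[OF r inj r assms(3) \<gamma>] mat_trace_l_prod_nonzero[OF r inj]
      by (simp add: K_def)
  qed
  show "B_invariant_on n (mu_zero_rss n) (K \<gamma> \<nu>)"
    unfolding B_invariant_on_def using act_mu_zero_rss K_act \<gamma> assms(3) by blast
qed

end
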